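(* Let $n\geq 1$ be an integer and $t\in(0,1)$. Let $\phi_0,\dots,\phi_n$ be the Krawtchouk polynomials with parameters $n,t$, regarded as functions on $\{0,\dots,n\}$, and set $\phi_{-1}=\phi_{n+1}=0$. For every $r \in \{0,\ldots, n \}$, as functions on $\{0,\dots,n\}$: (1) $\displaystyle \nabla_n \phi_r = \frac{r(n-r+1)}{n(1-t)}\, \phi_{r-1}$; (2) $\displaystyle \widetilde{\nabla}_n \phi_r = \frac{1}{nt}\, \phi_{r+1}$; (3) $\phi_r$ is an eigenfunction of the linear map $\widetilde{\nabla}_n \circ \nabla_n$, with $$\left( \widetilde{\nabla}_n \circ \nabla_n \right) \phi_r = \frac{r(n-r+1)}{n^2t(1-t)}\, \phi_r.$$
   Context: Let $b_{n,t}(k) = \binom{n}{k} t^k (1-t)^{n-k}$ for $k\in\{0,\dots,n\}$. The operator $\nabla_n$ acts on functions $f:\{0,\dots,n\}\to\mathbb{R}$ by $$(\nabla_n f)(k) = \frac{k}{n}\bigl(f(k)-f(k-1)\bigr) + \frac{n-k}{n}\bigl(f(k+1)-f(k)\bigr).$$ The operator $\widetilde{\nabla}_n$ is the adjoint of $\nabla_n$ for the scalar product $\langle f,g\rangle = \sum_{k=0}^n f(k)g(k)b_{n,t}(k)$ on functions $\{0,\dots,n\}\to\mathbb{R}$; explicitly $$(\widetilde{\nabla}_n f)(k) = \frac{k}{n}\,\frac{1-t}{t}\, f(k-1)-\frac{n-2k}{n}\, f(k) - \frac{n-k}{n}\, \frac{t}{1-t}\, f(k+1).$$ In both formulas, terms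 involving $f(-1)$ or $f(n+1)$ have coefficient $0$ and are omitted. The Krawtchouk polynomials $\phi_0,\dots,\phi_n$ (with $\deg \phi_r=r$) are determined, for $k\in\{0,\dots,n\}$, by the generating function identity in the variable $w$ $$\sum_{r=0}^n \frac{(1-t)^r}{r!}\, \phi_r(k)\, w^r = (1+(1-t)w)^k(1-tw)^{n-k}.$$ They satisfy $\sum_{k=0}^n \phi_r(k)\phi_s(k)b_{n,t}(k) = \frac{n!\,r!}{(n-r)!}\left(\frac{t}{1-t}\right)^r\delta_{rs}$. *)

theory Defs
  imports Complex_Main "HOL-Computational_Algebra.Polynomial"
begin

text \<open>
  A function on \<open>{0, ..., n}\<close> is represented by any \<open>f :: nat \<Rightarrow> real\<close>; only its values at
  \<open>k \<le> n\<close> matter, and equality of such functions is equality at all \<open>k \<le> n\<close>.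
\<close>

definition bernstein :: "nat \<Rightarrow> real \<Rightarrow> nat \<Rightarrow> real" where
  "bernstein n t k = real (n choose k) * t ^ k * (1 - t) ^ (n - k)"

text \<open>
  In the two operators below, at \<open>k = 0\<close> the value \<open>f (k - 1)\<close> (truncated subtraction) has
  coefficient \<open>0\<close>, and at \<open>k = n\<close> the value \<open>f (k + 1)\<close> has coefficient \<open>0\<close>; these terms
  are thus omitted.
\<close>

definition nabla :: "nat \<Rightarrow> (nat \<Rightarrow> real) \<Rightarrow> nat \<Rightarrow> real" where
  "nabla n f k =
     real k / real n * (f k - f (k - 1))
     + (real n - real k) / real n * (f (k + 1) - f k)"

definition nabla_adj :: "nat \<Rightarrow> real \<Rightarrow> (nat \<Rightarrow> real) \<Rightarrow> nat \<Rightarrow> real" where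
  "nabla_adj n t f k =
     real k / real n * ((1 - t) / t) * f (k - 1)
     - (real n - 2 * real k) / real n * f k
     - (real n - real k) / real n * (t / (1 - t)) * f (k + 1)"

text \<open>
  The Krawtchouk polynomial \<open>\<phi>\<^sub>r\<close> as a function on \<open>{0, ..., n}\<close>, read off as a coefficient of the
  generating polynomial \<open>(1 + (1 - t) w)\<^sup>k (1 - t w)\<^sup>n\<^sup>-\<^sup>k\<close> in \<open>w\<close>. The index is an integer so that
  \<open>\<phi>\<^sub>-\<^sub>1 = \<phi>\<^sub>n\<^sub>+\<^sub>1 = 0\<close> are literal instances.
\<close>

definition krawtchouk :: "nat \<Rightarrow> real \<Rightarrow> int \<Rightarrow> nat \<Rightarrow> real" where
  "krawtchouk n t r k =
     (if 0 \<le> r \<and> r \<le> int n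
      then fact (nat r) / (1 - t) ^ nat r
             * coeff ([:1, 1 - t:] ^ k * [:1, - t:] ^ (n - k)) (nat r)
      else 0)"

lemma nabla_cong:
  assumes "\<And>j. j \<le> n \<Longrightarrow> f j = g j" "k \<le> n"
  shows "nabla n f k = nabla n g k"
  using assms by (cases "k = n") (auto simp: nabla_def)

lemma nabla_adj_cong:
  assumes "\<And>j. j \<le> n \<Longrightarrow> f j = g j" "k \<le> n"
  shows "nabla_adj n t f k = nabla_adj n t g k"
  using assms by (cases "k = n") (auto simp: nabla_adj_def)

lemma nabla_linear:
  "nabla n (\<lambda>j. a * f j + b * g j) k = a * nabla n f k + b * nabla n g k"
  unfolding nabla_def by algebra

lemma nabla_adj_linear:
  "nabla_adj n t (\<lambda>j. a * f j + b * g j) k = a * nabla_adj n t f k + b * nabla_adj n t g k"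
  unfolding nabla_adj_def by algebra

text \<open>\<^const>\<open>nabla_adj\<close> is the adjoint of \<^const>\<open>nabla\<close> for the weight \<^const>\<open>bernstein\<close>.\<close>

lemma bernstein_Suc:
  assumes "0 < t" "t < 1" "k < n"
  shows "real (Suc k) * bernstein n t (Suc k) * (1 - t) = (real n - real k) * bernstein n t k * t"
proof -
  have "Suc k * (n choose Suc k) = (n - k) * (n choose k)"
    using binomial_absorb_comp[of n k] binomial_absorption[of k n] by simp
  then have c: "real (Suc k) * real (n choose Suc k) = (real n - real k) * real (n choose k)"
    using assms(3) by (metis of_nat_mult of_nat_diff less_imp_le)
  have e: "(1 - t) ^ (n - k) = (1 - t) ^ (n - Suc k) * (1 - t)"
    using assms(3) by (metis Suc_diff_Suc power_Suc2)
  have "real (Suc k) * bernstein n t (Suc k) * (1 - t)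
        = (real (Suc k) * real (n choose Suc k)) * t ^ Suc k * ((1 - t) ^ (n - Suc k) * (1 - t))"
    by (simp add: bernstein_def)
  also have "\<dots> = (real n - real k) * bernstein n t k * t"
    unfolding c e[symmetric] by (simp add: bernstein_def)
  finally show ?thesis .
qed

lemma nabla_adj_is_adjoint:
  assumes t: "0 < t" "t < 1"
  shows "(\<Sum>k\<le>n. nabla n f k * g k * bernstein n t k)
         = (\<Sum>k\<le>n. f k * nabla_adj n t g k * bernstein n t k)"
proof -
  define b where "b = bernstein n t"
  define c where "c k = real k * b k / n * f (k - 1) * g k
                        + real k * b k * ((1 - t) / t) / n * f k * g (k - 1)" for k
  have s: "real (Suc k) * b (Suc k) * ((1 - t) / t) = (real n - real k) * b k" if "k \<le> n" for k
  proof (cases "k = n")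
    case True
    then show ?thesis by (simp add: b_def bernstein_def)
  next
    case False
    then show ?thesis using bernstein_Suc[OF t, of k n] that t by (simp add: b_def field_simps)
  qed
  have s': "real (Suc k) * b (Suc k) = (real n - real k) * b k * (t / (1 - t))" if "k \<le> n" for k
    using s[OF that, symmetric] t by (simp add: field_simps)
  have "nabla n f k * g k * b k - f k * nabla_adj n t g k * b k = c (Suc k) - c k"
    if "k \<le> n" for k
  proof -
    have cS: "c (Suc k) = (real n - real k) * b k * (t / (1 - t)) / n * f k * g (Suc k)
                      + (real n - real k) * b k / n * f (Suc k) * g k"
      unfolding c_def s[OF that] by (simp add: s'[OF that] del: of_nat_Suc)
    define u v p q N where "u = (1 - t) / t" and "v = t / (1 - t)"
      and "p = f (k - 1)" and "q = g (k - 1)" and "N = inverse (real n)"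
    show ?thesis
      unfolding cS
      unfolding c_def nabla_def nabla_adj_def Suc_eq_plus1[symmetric] divide_inverse[of _ "real n"]
        u_def[symmetric] v_def[symmetric] p_def[symmetric] q_def[symmetric] N_def[symmetric]
      by algebra
  qed
  then have "(\<Sum>k\<le>n. nabla n f k * g k * b k) - (\<Sum>k\<le>n. f k * nabla_adj n t g k * b k)
             = (\<Sum>k\<le>n. c (Suc k) - c k)"
    by (simp add: sum_subtractf[symmetric])
  also have "\<dots> = c (Suc n) - c 0"
    by (induction n) simp_all
  also have "\<dots> = 0"
    by (simp add: c_def b_def bernstein_def binomial_eq_0)
  finally show ?thesis by (simp add: b_def)
qed

text \<open>The generating function identity holds for \<^const>\<open>krawtchouk\<close> and determines it.\<close>

lemma krawtchouk_generating_function: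
  assumes "t < 1" "k \<le> n"
  shows "(\<Sum>r\<le>n. (1 - t) ^ r / fact r * krawtchouk n t (int r) k * w ^ r)
         = (1 + (1 - t) * w) ^ k * (1 - t * w) ^ (n - k)"
proof -
  define p where "p = [:1, 1 - t:] ^ k * [:1, - t:] ^ (n - k)"
  have "degree p \<le> k + (n - k)"
    unfolding p_def
    by (intro order.trans[OF degree_mult_le] add_mono order.trans[OF degree_power_le]) auto
  then have d: "degree p \<le> n" using assms by simp
  have "(\<Sum>r\<le>n. (1 - t) ^ r / fact r * krawtchouk n t (int r) k * w ^ r)
        = (\<Sum>r\<le>n. coeff p r * w ^ r)"
    using assms by (intro sum.cong) (auto simp: krawtchouk_def p_def)
  also have "\<dots> = (\<Sum>r\<le>degree p. coeff p r * w ^ r)"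
    using d by (intro sum.mono_neutral_right) (auto simp: coeff_eq_0)
  also have "\<dots> = poly p w" by (simp add: poly_altdef)
  also have "\<dots> = (1 + (1 - t) * w) ^ k * (1 - t * w) ^ (n - k)"
    by (simp add: p_def mult.commute)
  finally show ?thesis .
qed

lemma krawtchouk_unique:
  assumes "t < 1" "k \<le> n"
    and "\<And>w. (\<Sum>r\<le>n. (1 - t) ^ r / fact r * phi r * w ^ r)
              = (1 + (1 - t) * w) ^ k * (1 - t * w) ^ (n - k)"
    and "r \<le> n"
  shows "phi r = krawtchouk n t (int r) k"
proof -
  have "\<forall>w. (\<Sum>r\<le>n. ((1 - t) ^ r / fact r * phi r) * w ^ r)
        = (\<Sum>r\<le>n. ((1 - t) ^ r / fact r * krawtchouk n t (int r) k) * w ^ r)"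
    using assms krawtchouk_generating_function[OF assms(1,2)] by simp
  then have "(1 - t) ^ r / fact r * phi r = (1 - t) ^ r / fact r * krawtchouk n t (int r) k"
    using assms(4) by (subst (asm) polyfun_eq_coeffs) simp
  then show ?thesis using assms(1) by simp
qed

text \<open>\<open>\<phi>\<^sub>r\<close> is indeed given by a polynomial of degree \<open>r\<close> in \<open>k\<close>.\<close>

lemma choose_poly:
  fixes a s :: real
  assumes "s \<noteq> 0"
  obtains p :: "real poly" where "degree p \<le> j" "coeff p j = s ^ j / fact j"
    "\<And>x. poly p x = (a + s * x) gchoose j"
proof -
  define q :: "real poly" where "q = (\<Prod>i<j. [:a - of_nat i, s:])"
  have d: "degree q = j"
    unfolding q_def using assms by (subst degree_prod_sum_eq) auto
  have "lead_coeff q = s ^ j"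
    unfolding q_def lead_coeff_prod using assms by simp
  then have "coeff (smult (1 / fact j) q) j = s ^ j / fact j" using d by simp
  moreover have "poly (smult (1 / fact j) q) x = (a + s * x) gchoose j" for x
    by (simp add: q_def gbinomial_prod_rev poly_prod atLeast0LessThan algebra_simps)
  ultimately show ?thesis using that[of "smult (1 / fact j) q"] d by simp
qed

lemma coeff_linear_power':
  "coeff ([:1, c:] ^ m) i = real (m choose i) * c ^ i"
proof (cases "i \<le> m")
  case True
  then show ?thesis by (simp add: coeff_linear_poly_power)
next
  case False
  have "degree ([:1, c:] ^ m) \<le> 1 * m"
    by (rule order.trans[OF degree_power_le]) auto
  then show ?thesis using False by (simp add: coeff_eq_0 binomial_eq_0)
qed

lemma krawtchouk_polynomial:
  assumes t: "0 < t" "t < 1" and r: "r \<le> n"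
  shows "\<exists>p :: real poly. degree p = r \<and> (\<forall>k\<le>n. poly p (real k) = krawtchouk n t (int r) k)"
proof -
  have "\<exists>p :: real poly. degree p \<le> j \<and> coeff p j = 1 / fact j \<and> (\<forall>x. poly p x = x gchoose j)" for j
    using choose_poly[of 1 j 0] by (metis add_0 mult_1 power_one zero_neq_one)
  then obtain A :: "nat \<Rightarrow> real poly" where A: "\<And>j. degree (A j) \<le> j"
      "\<And>j. coeff (A j) j = 1 / fact j" "\<And>j x. poly (A j) x = x gchoose j"
    by metis
  have "\<exists>p :: real poly. degree p \<le> j \<and> coeff p j = (-1) ^ j / fact j
          \<and> (\<forall>x. poly p x = (real n - x) gchoose j)" for j
    using choose_poly[of "-1" j "real n"] by (metis (no_types, lifting) add.commute
        mult_minus1 uminus_add_conv_diff neg_equal_0_iff_equal zero_neq_one)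
  then obtain B :: "nat \<Rightarrow> real poly" where B: "\<And>j. degree (B j) \<le> j"
      "\<And>j. coeff (B j) j = (-1) ^ j / fact j" "\<And>j x. poly (B j) x = (real n - x) gchoose j"
    by metis
  define c where "c j = fact r / (1 - t) ^ r * ((1 - t) ^ j * (- t) ^ (r - j))" for j
  define p where "p = (\<Sum>j\<le>r. smult (c j) (A j * B (r - j)))"
  have dAB: "degree (A j * B (r - j)) \<le> r" if "j \<le> r" for j
    using order.trans[OF degree_mult_le add_mono[OF A(1)[of j] B(1)[of "r - j"]]] that by simp
  have le: "degree p \<le> r"
    unfolding p_def using dAB
    by (intro degree_sum_le) (auto intro: order.trans[OF degree_smult_le])
  have cAB: "coeff (A j * B (r - j)) r = 1 / fact j * ((-1) ^ (r - j) / fact (r - j))"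
    if "j \<le> r" for j
  proof -
    have "coeff (A j * B (r - j)) (j + (r - j)) = coeff (A j) j * coeff (B (r - j)) (r - j)"
      using A(1)[of j] B(1)[of "r - j"]
      by (smt (verit) coeff_eq_0 coeff_mult_degree_sum degree_mult_le le_antisym le_degree
          mult_eq_0_iff nat_less_le not_less add_less_le_mono add_le_less_mono le_less_trans)
    then show ?thesis using that by (simp add: A B)
  qed
  have "coeff p r = (\<Sum>j\<le>r. c j * (1 / fact j * ((-1) ^ (r - j) / fact (r - j))))"
    unfolding p_def by (simp add: coeff_sum cAB)
  also have "\<dots> = (\<Sum>j\<le>r. 1 / (1 - t) ^ r * (of_nat (r choose j) * (1 - t) ^ j * t ^ (r - j)))"
  proof (intro sum.cong refl)
    fix j assume "j \<in> {..r}"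
    then have "real (r choose j) = fact r / (fact j * fact (r - j))"
      by (simp add: binomial_fact)
    moreover have "(- t) ^ (r - j) * (-1) ^ (r - j) = t ^ (r - j)"
      by (simp add: power_mult_distrib[symmetric])
    moreover have "c j * (1 / fact j * ((-1) ^ (r - j) / fact (r - j)))
        = 1 / (1 - t) ^ r * (fact r / (fact j * fact (r - j)) * (1 - t) ^ j
            * ((- t) ^ (r - j) * (-1) ^ (r - j)))"
      unfolding c_def by simp
    ultimately show "c j * (1 / fact j * ((-1) ^ (r - j) / fact (r - j)))
        = 1 / (1 - t) ^ r * (of_nat (r choose j) * (1 - t) ^ j * t ^ (r - j))"
      by (simp only:)
  qed
  also have "\<dots> = 1 / (1 - t) ^ r * ((1 - t) + t) ^ r"
    unfolding binomial_ring sum_distrib_left ..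
  finally have "coeff p r \<noteq> 0" using t by simp
  then have "degree p = r" using le le_degree le_antisym by blast
  moreover have "poly p (real k) = krawtchouk n t (int r) k" if "k \<le> n" for k
  proof -
    have "poly p (real k) = (\<Sum>j\<le>r. c j * (real (k choose j) * real ((n - k) choose (r - j))))"
      using that by (simp add: p_def poly_sum A B binomial_gbinomial)
    also have "\<dots> = krawtchouk n t (int r) k"
      using r by (simp add: krawtchouk_def coeff_mult coeff_linear_power' c_def sum_distrib_left
          algebra_simps sum_divide_distrib)
    finally show ?thesis .
  qed
  ultimately show ?thesis by blast
qed

end

theory Submission
  imports Defs
begin

text \<open>
  Fix \<open>k\<close> and put \<open>G\<^sub>k(w) = a\<^sup>k b\<^sup>n\<^sup>-\<^sup>k\<close> with \<open>a = 1 + (1 - t) w\<close> and \<open>b = 1 - t w\<close>. Up to the factor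
  \<open>r! / (1 - t)\<^sup>r\<close>, the function \<open>\<phi>\<^sub>r\<close> is the coefficient of \<open>w\<^sup>r\<close> in \<open>G\<^sub>k\<close>, and both operators
  act on \<open>k\<close> only. They can therefore be computed on the whole generating function, where they
  become differential operators in \<open>w\<close>: since \<open>a - b = w\<close> and \<open>(1 - t) b + t a = 1\<close>,
  \[ \nabla_n G_k = (w / n) (n G_k - w G_k'), \qquad
     \widetilde\nabla_n G_k = G_k' / (n t (1 - t)). \]
  The first one lowers \<open>\<phi>\<^sub>r\<close> and the second one raises it, as comparison of coefficients of
  \<open>w\<^sup>r\<close> shows (lemmas \<open>nabla_coeff_gf\<close> and \<open>nabla_adj_coeff_gf\<close>). The eigenvalue is the product of
  the two factors, and \<open>\<phi>\<^sub>r\<close> is not zero because \<open>\<phi>\<^sub>r(0)\<close> is a nonzero multiple of the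
  coefficient of \<open>w\<^sup>r\<close> in \<open>(1 - t w)\<^sup>n\<close>.
\<close>

definition krawtchouk_gf :: "nat \<Rightarrow> real \<Rightarrow> nat \<Rightarrow> real poly" where
  "krawtchouk_gf n t k = [:1, 1 - t:] ^ k * [:1, - t:] ^ (n - k)"

lemma krawtchouk_eq_coeff_gf:
  "r \<le> n \<Longrightarrow> krawtchouk n t (int r) = (\<lambda>k. fact r / (1 - t) ^ r * coeff (krawtchouk_gf n t k) r)"
  by (simp add: krawtchouk_def krawtchouk_gf_def fun_eq_iff)

lemma degree_krawtchouk_gf_le:
  assumes "k \<le> n"
  shows "degree (krawtchouk_gf n t k) \<le> n"
proof -
  have "degree (krawtchouk_gf n t k) \<le> k + (n - k)"
    unfolding krawtchouk_gf_def
    by (intro order.trans[OF degree_mult_le] add_mono order.trans[OF degree_power_le]) auto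
  then show ?thesis using assms by simp
qed

lemma nabla_scale: "nabla n (\<lambda>j. c * f j) k = c * nabla n f k"
  using nabla_linear[of n c f 0 f k] by simp

lemma nabla_adj_scale: "nabla_adj n t (\<lambda>j. c * f j) k = c * nabla_adj n t f k"
  using nabla_adj_linear[of n t c f 0 f k] by simp

text \<open>
  The two terms of the product rule for \<open>G\<^sub>k'\<close>, without their constants, are
  \<open>U = k a\<^sup>k\<^sup>-\<^sup>1 b\<^sup>n\<^sup>-\<^sup>k\<close> and \<open>V = (n - k) a\<^sup>k b\<^sup>n\<^sup>-\<^sup>k\<^sup>-\<^sup>1\<close>. Every neighbour of \<open>G\<^sub>k\<close> with the weight that it
  has in the two operators is a multiple of one of them, which also covers the endpoints
  \<open>k = 0\<close> and \<open>k = n\<close>, where \<open>U\<close> or \<open>V\<close> vanishes.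
\<close>

lemma krawtchouk_gf_neighbours:
  assumes "k \<le> n"
  obtains U V where
    "smult (real k) (krawtchouk_gf n t k) = U * [:1, 1 - t:]"
    "smult (real k) (krawtchouk_gf n t (k - 1)) = U * [:1, - t:]"
    "smult (real n - real k) (krawtchouk_gf n t k) = V * [:1, - t:]"
    "smult (real n - real k) (krawtchouk_gf n t (k + 1)) = V * [:1, 1 - t:]"
    "pderiv (krawtchouk_gf n t k) = smult (1 - t) U - smult t V"
proof
  define a b where "a = [:1, 1 - t:]" and "b = [:1, - t:]"
  define U where "U = smult (real k) (a ^ (k - 1) * b ^ (n - k))"
  define V where "V = smult (real n - real k) (a ^ k * b ^ (n - k - 1))"
  note defs = U_def V_def krawtchouk_gf_def a_def[symmetric] b_def[symmetric]
  have a: "a ^ k = a * a ^ (k - 1)" and b': "b ^ (n - (k - 1)) = b * b ^ (n - k)" if "k \<noteq> 0"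
    using that assms by (simp_all flip: power_Suc add: Suc_diff_le)
  have b: "b ^ (n - k) = b * b ^ (n - k - 1)" if "k \<noteq> n"
    using that assms by (simp add: power_eq_if[of b "n - k"])
  show "smult (real k) (krawtchouk_gf n t k) = U * [:1, 1 - t:]"
    unfolding defs using a by (cases "k = 0") (simp_all add: mult_ac)
  show "smult (real k) (krawtchouk_gf n t (k - 1)) = U * [:1, - t:]"
    unfolding defs using b' by (cases "k = 0") (simp_all add: mult_ac)
  show "smult (real n - real k) (krawtchouk_gf n t k) = V * [:1, - t:]"
    unfolding defs using b by (cases "k = n") (simp_all add: mult_ac)
  show "smult (real n - real k) (krawtchouk_gf n t (k + 1)) = V * [:1, 1 - t:]"
    unfolding defs by (simp add: mult_ac)
  have da: "pderiv a = [:1 - t:]" and db: "pderiv b = [:- t:]"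
    by (simp_all add: a_def b_def pderiv_pCons)
  have pow: "pderiv (p ^ m) = smult (real m) (p ^ (m - 1) * pderiv p)" for p :: "real poly" and m
    by (cases m) (simp_all add: pderiv_power_Suc del: power_Suc of_nat_Suc)
  have "pderiv (krawtchouk_gf n t k)
      = smult (real k * (1 - t)) (a ^ (k - 1) * b ^ (n - k))
        + smult (real (n - k) * (- t)) (a ^ k * b ^ (n - k - 1))"
    unfolding defs by (simp add: pderiv_mult pow da db mult_ac)
  then show "pderiv (krawtchouk_gf n t k) = smult (1 - t) U - smult t V"
    using assms by (simp add: U_def V_def of_nat_diff mult_ac)
qed

text \<open>
  As \<open>a - b = w\<close>, the differences of \<open>G\<close> sum up to \<open>w (U + V)\<close>; and \<open>n G\<^sub>k - w G\<^sub>k'\<close> is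
  \<open>U (a - (1 - t) w) + V (b + t w) = U + V\<close>.
\<close>

lemma nabla_gf:
  assumes "k \<le> n"
  shows "smult (real k) (krawtchouk_gf n t k) - smult (real k) (krawtchouk_gf n t (k - 1))
       + (smult (real n - real k) (krawtchouk_gf n t (k + 1))
          - smult (real n - real k) (krawtchouk_gf n t k))
     = pCons 0 (smult (real n) (krawtchouk_gf n t k) - pCons 0 (pderiv (krawtchouk_gf n t k)))"
proof -
  obtain U V where UV:
    "smult (real k) (krawtchouk_gf n t k) = U * [:1, 1 - t:]"
    "smult (real k) (krawtchouk_gf n t (k - 1)) = U * [:1, - t:]"
    "smult (real n - real k) (krawtchouk_gf n t k) = V * [:1, - t:]"
    "smult (real n - real k) (krawtchouk_gf n t (k + 1)) = V * [:1, 1 - t:]"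
    "pderiv (krawtchouk_gf n t k) = smult (1 - t) U - smult t V"
    using krawtchouk_gf_neighbours[OF assms] .
  have "smult (real n) (krawtchouk_gf n t k) = U * [:1, 1 - t:] + V * [:1, - t:]"
    unfolding UV(1,3)[symmetric] smult_add_left[symmetric] by simp
  then have "smult (real n) (krawtchouk_gf n t k) - pCons 0 (pderiv (krawtchouk_gf n t k)) = U + V"
    unfolding UV(5) by (intro poly_eqI) (simp add: coeff_pCons algebra_simps split: nat.split)
  then show ?thesis
    unfolding UV by (intro poly_eqI) (simp add: coeff_pCons algebra_simps split: nat.split)
qed

text \<open>
  The left-hand side is \<open>(1 - t)\<^sup>2 U b - t\<^sup>2 V a + t (1 - t) (U a - V b)\<close>, because
  \<open>n - 2k = (n - k) - k\<close>; now \<open>(1 - t) b + t a = 1\<close> leaves \<open>(1 - t) U - t V = G\<^sub>k'\<close>.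
\<close>

lemma nabla_adj_gf:
  assumes "k \<le> n"
  shows "smult ((1 - t)\<^sup>2) (smult (real k) (krawtchouk_gf n t (k - 1)))
       - smult (t * (1 - t)) (smult (real n - 2 * real k) (krawtchouk_gf n t k))
       - smult (t\<^sup>2) (smult (real n - real k) (krawtchouk_gf n t (k + 1)))
     = pderiv (krawtchouk_gf n t k)"
proof -
  obtain U V where UV:
    "smult (real k) (krawtchouk_gf n t k) = U * [:1, 1 - t:]"
    "smult (real k) (krawtchouk_gf n t (k - 1)) = U * [:1, - t:]"
    "smult (real n - real k) (krawtchouk_gf n t k) = V * [:1, - t:]"
    "smult (real n - real k) (krawtchouk_gf n t (k + 1)) = V * [:1, 1 - t:]"
    "pderiv (krawtchouk_gf n t k) = smult (1 - t) U - smult t V"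
    using krawtchouk_gf_neighbours[OF assms] .
  have mid: "smult (real n - 2 * real k) (krawtchouk_gf n t k) = V * [:1, - t:] - U * [:1, 1 - t:]"
    unfolding UV(1,3)[symmetric] smult_diff_left[symmetric] by simp
  show ?thesis
    unfolding mid UV
    by (intro poly_eqI)
      (simp add: coeff_pCons algebra_simps power2_eq_square split: nat.split)
qed

lemma nabla_coeff_gf:
  assumes "n \<ge> 1" "k \<le> n"
  shows "nabla n (\<lambda>j. coeff (krawtchouk_gf n t j) (Suc r)) k
       = (real n - real r) / real n * coeff (krawtchouk_gf n t k) r"
proof -
  have "real n * nabla n (\<lambda>j. coeff (krawtchouk_gf n t j) (Suc r)) k
      = real k * coeff (krawtchouk_gf n t k) (Suc r)
        - real k * coeff (krawtchouk_gf n t (k - 1)) (Suc r)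
        + ((real n - real k) * coeff (krawtchouk_gf n t (k + 1)) (Suc r)
        - (real n - real k) * coeff (krawtchouk_gf n t k) (Suc r))"
    unfolding nabla_def using assms(1) by (simp add: field_simps)
  also have "\<dots> = (real n - real r) * coeff (krawtchouk_gf n t k) r"
    using arg_cong[OF nabla_gf[OF assms(2), of t], of "\<lambda>p. coeff p (Suc r)"]
    by (cases r) (simp_all add: coeff_pCons coeff_pderiv algebra_simps)
  finally show ?thesis using assms(1) by (simp add: field_simps)
qed

lemma nabla_coeff_gf_0: "nabla n (\<lambda>j. coeff (krawtchouk_gf n t j) 0) k = 0"
  by (simp add: nabla_def krawtchouk_gf_def coeff_0_power coeff_mult_0)

lemma nabla_adj_coeff_gf:
  assumes "n \<ge> 1" "0 < t" "t < 1" "k \<le> n"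
  shows "nabla_adj n t (\<lambda>j. coeff (krawtchouk_gf n t j) r) k
       = real (Suc r) / (real n * t * (1 - t)) * coeff (krawtchouk_gf n t k) (Suc r)"
proof -
  define s where "s = 1 - t"
  have s: "s \<noteq> 0" using assms(3) by (simp add: s_def)
  have "real n * t * (1 - t) * nabla_adj n t (\<lambda>j. coeff (krawtchouk_gf n t j) r) k
      = (1 - t)\<^sup>2 * (real k * coeff (krawtchouk_gf n t (k - 1)) r)
        - t * (1 - t) * ((real n - 2 * real k) * coeff (krawtchouk_gf n t k) r)
        - t\<^sup>2 * ((real n - real k) * coeff (krawtchouk_gf n t (k + 1)) r)"
    unfolding nabla_adj_def s_def[symmetric] using assms(1,2) s
    by (simp add: field_simps power2_eq_square)
  also have "\<dots> = real (Suc r) * coeff (krawtchouk_gf n t k) (Suc r)"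
    using arg_cong[OF nabla_adj_gf[OF assms(4), of t], of "\<lambda>p. coeff p r"]
    by (simp add: coeff_pderiv del: of_nat_Suc)
  finally show ?thesis using assms by (simp add: field_simps del: of_nat_Suc)
qed

lemma nabla_krawtchouk:
  assumes "n \<ge> 1" "t < 1" "r \<le> n" "k \<le> n"
  shows "nabla n (krawtchouk n t (int r)) k
       = real r * (real n - real r + 1) / (real n * (1 - t)) * krawtchouk n t (int r - 1) k"
proof (cases r)
  case 0
  then show ?thesis
    using krawtchouk_eq_coeff_gf[of 0 n t] nabla_coeff_gf_0[of n t k] by simp
next
  case (Suc m)
  have "nabla n (krawtchouk n t (int r)) k
      = fact r / (1 - t) ^ r * ((real n - real m) / real n * coeff (krawtchouk_gf n t k) m)"
    unfolding krawtchouk_eq_coeff_gf[OF assms(3)] nabla_scale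
    by (simp only: Suc nabla_coeff_gf[OF assms(1,4)])
  moreover have "krawtchouk n t (int r - 1) k
      = fact m / (1 - t) ^ m * coeff (krawtchouk_gf n t k) m"
    using krawtchouk_eq_coeff_gf[of m n t] Suc assms(3) by simp
  moreover have "fact r / (1 - t) ^ r = real r / (1 - t) * (fact m / (1 - t) ^ m)"
    by (simp add: Suc)
  moreover have "real n - real r + 1 = real n - real m"
    by (simp add: Suc)
  ultimately show ?thesis by (simp only:) (simp add: mult_ac)
qed

lemma nabla_adj_krawtchouk:
  assumes "n \<ge> 1" "0 < t" "t < 1" "r \<le> n" "k \<le> n"
  shows "nabla_adj n t (krawtchouk n t (int r)) k
       = 1 / (real n * t) * krawtchouk n t (int r + 1) k"
proof -
  have lhs: "nabla_adj n t (krawtchouk n t (int r)) k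
      = fact r / (1 - t) ^ r
        * (real (Suc r) / (real n * t * (1 - t)) * coeff (krawtchouk_gf n t k) (Suc r))"
    unfolding krawtchouk_eq_coeff_gf[OF assms(4)] nabla_adj_scale
    by (simp only: nabla_adj_coeff_gf[OF assms(1-3,5)])
  show ?thesis
  proof (cases "r = n")
    case True
    \<comment> \<open>The formula produces the coefficient of \<open>w\<^sup>n\<^sup>+\<^sup>1\<close>, which agrees with \<open>\<phi>\<^sub>n\<^sub>+\<^sub>1 = 0\<close>
      because \<open>G\<^sub>k\<close> has degree at most \<open>n\<close>.\<close>
    then have "coeff (krawtchouk_gf n t k) (Suc r) = 0"
      using degree_krawtchouk_gf_le[OF assms(5), of t] by (simp add: coeff_eq_0)
    then show ?thesis using lhs True by (simp add: krawtchouk_def)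
  next
    case False
    have "int r + 1 = int (Suc r)" by simp
    then have "krawtchouk n t (int r + 1) k
        = fact (Suc r) / (1 - t) ^ Suc r * coeff (krawtchouk_gf n t k) (Suc r)"
      using krawtchouk_eq_coeff_gf[of "Suc r" n t] assms(4) False by (simp only: Suc_le_eq le_neq_implies_less)
    then show ?thesis using lhs by (simp add: mult_ac)
  qed
qed

lemma krawtchouk_at_0_nonzero:
  assumes "0 < t" "t < 1" "r \<le> n"
  shows "krawtchouk n t (int r) 0 \<noteq> 0"
  using assms by (simp add: krawtchouk_def coeff_linear_power')

theorem proposition3p2:
  fixes n r :: nat and t :: real
  assumes "n \<ge> 1" and "0 < t" and "t < 1" and "r \<le> n"
  shows "(\<forall>k\<le>n. nabla n (krawtchouk n t (int r)) k
              = real r * (real n - real r + 1) / (real n * (1 - t))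
                * krawtchouk n t (int r - 1) k)
       \<and> (\<forall>k\<le>n. nabla_adj n t (krawtchouk n t (int r)) k
              = 1 / (real n * t) * krawtchouk n t (int r + 1) k)
       \<and> (\<exists>k\<le>n. krawtchouk n t (int r) k \<noteq> 0)
       \<and> (\<forall>k\<le>n. (nabla_adj n t \<circ> nabla n) (krawtchouk n t (int r)) k
              = real r * (real n - real r + 1) / ((real n)\<^sup>2 * t * (1 - t))
                * krawtchouk n t (int r) k)"
proof (intro conjI allI impI)
  fix k assume k: "k \<le> n"
  define c where "c = real r * (real n - real r + 1) / (real n * (1 - t))"
  have lower: "nabla n (krawtchouk n t (int r)) j = c * krawtchouk n t (int r - 1) j"
    if "j \<le> n" for j
    unfolding c_def using nabla_krawtchouk[OF assms(1,3,4) that] .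
  have "nabla_adj n t (nabla n (krawtchouk n t (int r))) k
      = nabla_adj n t (\<lambda>j. c * krawtchouk n t (int r - 1) j) k"
    using lower k by (rule nabla_adj_cong)
  also have "\<dots> = c * nabla_adj n t (krawtchouk n t (int r - 1)) k"
    by (rule nabla_adj_scale)
  also have "\<dots> = c * (1 / (real n * t) * krawtchouk n t (int r) k)"
  proof (cases r)
    \<comment> \<open>The raising formula does not apply to \<open>\<phi>\<^sub>-\<^sub>1\<close>, but then \<open>c = 0\<close>.\<close>
    case 0
    then show ?thesis by (simp add: c_def)
  next
    case (Suc m)
    then show ?thesis
      using nabla_adj_krawtchouk[OF assms(1-3) _ k, of m] assms(4) by (simp add: add.commute)
  qed
  also have "\<dots> = real r * (real n - real r + 1) / ((real n)\<^sup>2 * t * (1 - t))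
                * krawtchouk n t (int r) k"
    by (simp add: c_def power2_eq_square)
  finally show "(nabla_adj n t \<circ> nabla n) (krawtchouk n t (int r)) k
              = real r * (real n - real r + 1) / ((real n)\<^sup>2 * t * (1 - t))
                * krawtchouk n t (int r) k"
    by simp
next
  show "\<exists>k\<le>n. krawtchouk n t (int r) k \<noteq> 0"
    using krawtchouk_at_0_nonzero[OF assms(2-4)] by blast
qed (rule nabla_krawtchouk[OF assms(1,3,4)] nabla_adj_krawtchouk[OF assms], assumption)+

end
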